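(* Let an Adinkra with $N$ colors and vertex set $V$ be given, with boson–fermion matrix $X$ and signed Laplacian $L$. Let $p$ be an odd prime dividing $N$. Then: (1) $p$ does not divide any of the first $\#V/4$ invariant factors of $X$; (2) $p$ does not divide any of the first $\#V/2$ invariant factors of $L$.
   Context: A signed graph is a finite undirected simple graph $(V,E)$ with a signature $\mu:E\to\{-1,1\}$; edges with $\mu(e)=-1$ are called dashed, those with $\mu(e)=1$ solid. An Adinkra with $N\ge 1$ colors is a non-empty finite bipartite signed graph $(V,E,\mu)$ (with a fixed bipartition of $V$ into bosons and fermions, every edge joining a boson to a fermion), together with an assignment of one of $N$ colors to each edge and a function $h:V\to\mathbb{Z}$ (the function $h$ plays no role here), such that: (i) each vertex is incident to exactly $N$ edges, one of each color; (ii) for any two distinct colors, the subgraph consisting of all edges of those two colors is a disjoint union of $4$-cycles (called bicolor cycles); (iii) every bicolor cycle contains an odd number of dashed edges; (iv) $|h(v)-h(w)|=1$ for adjacent $v,w$. An Adinkra need not be connected; there are $\#V/2$ bosons and $\#V/2$ fermions, and $\#V$ is a multiple of $4$ whenever $N\ge2$. $X$ is the $\frac{\#V}{2}\times\frac{\#V}{2}$ integer matrix whose $(i,j)$ entry is $\mu(e)$ if there is an edge $e$ between the $i$th boson and $j$th fermion, and $0$ otherwise. With bosons ordered first, the signed Laplacian is $L=\begin{pmatrix}NI&-X\\-X^T&NI\end{pmatrix}$. The invariant factors of an integer square matrix are the nonnegative diagonal entries $d_1\mid d_2\mid\cdots$ of its Smith Normal Form over $\mathbb{Z}$, listed in this order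 with multiplicity. *)

theory Defs
  imports
    "Jordan_Normal_Form.Gauss_Jordan_Elimination"
    "HOL-Computational_Algebra.Primes"
begin

section \<open>Adinkras\<close>

locale signed_graph =
  fixes V :: "'v set" and E :: "'v set set" and \<mu> :: "'v set \<Rightarrow> int"
  assumes finite_V: "finite V"
    and edges: "\<And>e. e \<in> E \<Longrightarrow> \<exists>v\<in>V. \<exists>w\<in>V. v \<noteq> w \<and> e = {v, w}"
    and signature: "\<And>e. e \<in> E \<Longrightarrow> \<mu> e \<in> {-1, 1}"

text \<open>Cycles are represented by their edge sets.\<close>

definition four_cycle :: "'v set set \<Rightarrow> bool" where
  "four_cycle C \<longleftrightarrow>
     (\<exists>a b c d. distinct [a, b, c, d] \<and> C = {{a, b}, {b, c}, {c, d}, {d, a}})"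

definition disjoint_union_of_four_cycles :: "'v set set \<Rightarrow> bool" where
  "disjoint_union_of_four_cycles S \<longleftrightarrow>
     (\<exists>\<C>. (\<forall>C\<in>\<C>. four_cycle C) \<and>
          (\<forall>C\<in>\<C>. \<forall>D\<in>\<C>. C \<noteq> D \<longrightarrow> \<Union>C \<inter> \<Union>D = {}) \<and>
          S = \<Union>\<C>)"

definition bicolor_edges :: "'v set set \<Rightarrow> ('v set \<Rightarrow> nat) \<Rightarrow> nat \<Rightarrow> nat \<Rightarrow> 'v set set" where
  "bicolor_edges E \<chi> i j = {e \<in> E. \<chi> e = i \<or> \<chi> e = j}"

text \<open>
  \<open>B\<close> is the set of bosons, \<open>F\<close> the set of fermions, and the colors are \<open>0, \<dots>, N - 1\<close>.
  If the edges of two colors form a disjoint union of 4-cycles, then the 4-cycles occurring in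
  that union are exactly the 4-cycles consisting of such edges.
\<close>

locale adinkra = signed_graph V E \<mu>
  for N :: nat and V :: "'v set" and B F :: "'v set" and E :: "'v set set"
    and \<mu> :: "'v set \<Rightarrow> int" and \<chi> :: "'v set \<Rightarrow> nat" and h :: "'v \<Rightarrow> int" +
  assumes N_pos: "N \<ge> 1"
    and V_nonempty: "V \<noteq> {}"
    and bipartition: "B \<union> F = V" "B \<inter> F = {}"
    and bipartite: "\<And>e. e \<in> E \<Longrightarrow> \<exists>b\<in>B. \<exists>f\<in>F. e = {b, f}"
    and colors: "\<And>e. e \<in> E \<Longrightarrow> \<chi> e < N"
    and regular: "\<And>v. v \<in> V \<Longrightarrow> card {e \<in> E. v \<in> e} = N"
    and one_of_each_color: "\<And>v i. v \<in> V \<Longrightarrow> i < N \<Longrightarrow> \<exists>!e. e \<in> E \<and> v \<in> e \<and> \<chi> e = i"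
    and bicolor_cycles: "\<And>i j. i < N \<Longrightarrow> j < N \<Longrightarrow> i \<noteq> j \<Longrightarrow>
          disjoint_union_of_four_cycles (bicolor_edges E \<chi> i j)"
    and odd_dashed: "\<And>i j C. i < N \<Longrightarrow> j < N \<Longrightarrow> i \<noteq> j \<Longrightarrow>
          C \<subseteq> bicolor_edges E \<chi> i j \<Longrightarrow> four_cycle C \<Longrightarrow> odd (card {e \<in> C. \<mu> e = -1})"
    and height: "\<And>v w. {v, w} \<in> E \<Longrightarrow> \<bar>h v - h w\<bar> = 1"

text \<open>
  The lists \<open>bs\<close> and \<open>fs\<close> enumerate the bosons and the fermions without repetition;
  both have length \<open>card V div 2\<close>.
\<close>

definition boson_fermion_mat ::
    "'v set set \<Rightarrow> ('v set \<Rightarrow> int) \<Rightarrow> 'v list \<Rightarrow> 'v list \<Rightarrow> int mat" where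
  "boson_fermion_mat E \<mu> bs fs = mat (length bs) (length fs)
     (\<lambda>(i, j). if {bs ! i, fs ! j} \<in> E then \<mu> {bs ! i, fs ! j} else 0)"

definition signed_laplacian :: "nat \<Rightarrow> int mat \<Rightarrow> int mat" where
  "signed_laplacian N X = four_block_mat
     (int N \<cdot>\<^sub>m 1\<^sub>m (dim_row X)) (- X)
     (- transpose_mat X) (int N \<cdot>\<^sub>m 1\<^sub>m (dim_col X))"


section \<open>Invariant factors\<close>

definition unimodular_equiv :: "int mat \<Rightarrow> int mat \<Rightarrow> bool" where
  "unimodular_equiv A D \<longleftrightarrow>
     (\<exists>P Q. P \<in> carrier_mat (dim_row A) (dim_row A) \<and> invertible_mat P \<and>
            Q \<in> carrier_mat (dim_col A) (dim_col A) \<and> invertible_mat Q \<and>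
            D = P * A * Q)"

definition smith_normal_form :: "int mat \<Rightarrow> int mat \<Rightarrow> bool" where
  "smith_normal_form A D \<longleftrightarrow>
     unimodular_equiv A D \<and> diagonal_mat D \<and>
     (\<forall>i. i < dim_row D \<and> i < dim_col D \<longrightarrow> D $$ (i, i) \<ge> 0) \<and>
     (\<forall>i. Suc i < dim_row D \<and> Suc i < dim_col D \<longrightarrow> D $$ (i, i) dvd D $$ (Suc i, Suc i))"

text \<open>For square \<open>A\<close>: \<open>ds\<close> lists the diagonal of a Smith normal form of \<open>A\<close> over the integers.\<close>

definition invariant_factors :: "int mat \<Rightarrow> int list \<Rightarrow> bool" where
  "invariant_factors A ds \<longleftrightarrow> (\<exists>D. smith_normal_form A D \<and> ds = diag_mat D)"


text \<open>Every integer matrix has a Smith normal form.\<close>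

lemma invertible_matI:
  assumes "P \<in> carrier_mat n n" "P' \<in> carrier_mat n n" "P * P' = 1\<^sub>m n" "P' * P = 1\<^sub>m n"
  shows "invertible_mat P"
  using assms unfolding invertible_mat_def inverts_mat_def square_mat.simps by auto

lemma invertible_matE:
  assumes "invertible_mat P" "P \<in> carrier_mat n n"
  obtains P' where "P' \<in> carrier_mat n n" "P * P' = 1\<^sub>m n" "P' * P = 1\<^sub>m n"
proof -
  from assms obtain P' where *: "P * P' = 1\<^sub>m n" "P' * P = 1\<^sub>m (dim_row P')"
    unfolding invertible_mat_def inverts_mat_def by auto
  have "dim_col P' = n" using arg_cong[OF *(1), of dim_col] by simp
  moreover have "dim_row P' = n" using arg_cong[OF *(2), of dim_col] assms by simp
  ultimately show ?thesis using that * by auto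
qed

lemma invertible_one_mat: "invertible_mat (1\<^sub>m n :: int mat)"
  by (rule invertible_matI[where n = n and P' = "1\<^sub>m n"]) auto

lemma invertible_mult:
  fixes P Q :: "int mat"
  assumes P: "P \<in> carrier_mat n n" "invertible_mat P" and Q: "Q \<in> carrier_mat n n" "invertible_mat Q"
  shows "invertible_mat (P * Q)"
proof -
  obtain P' where P': "P' \<in> carrier_mat n n" "P * P' = 1\<^sub>m n" "P' * P = 1\<^sub>m n"
    using invertible_matE[OF P(2,1)] .
  obtain Q' where Q': "Q' \<in> carrier_mat n n" "Q * Q' = 1\<^sub>m n" "Q' * Q = 1\<^sub>m n"
    using invertible_matE[OF Q(2,1)] .
  have *: "(R * S) * (S' * R') = 1\<^sub>m n"
    if "R \<in> carrier_mat n n" "S \<in> carrier_mat n n" "S' \<in> carrier_mat n n" "R' \<in> carrier_mat n n"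
      "R * R' = 1\<^sub>m n" "S * S' = 1\<^sub>m n" for R S S' R' :: "int mat"
  proof -
    have "(R * S) * (S' * R') = R * (S * (S' * R'))"
      using that by (intro assoc_mult_mat[of _ n n _ n _ n]) auto
    also have "S * (S' * R') = S * S' * R'"
      using that by (intro assoc_mult_mat[symmetric, of _ n n _ n _ n]) auto
    finally show ?thesis using that by simp
  qed
  show ?thesis
    using P Q P' Q' *[of P Q Q' P'] *[of Q' P' P Q]
    by (intro invertible_matI[where n = n and P' = "Q' * P'"]) auto
qed

lemma invertible_transpose:
  fixes P :: "int mat"
  assumes P: "P \<in> carrier_mat n n" "invertible_mat P"
  shows "invertible_mat (transpose_mat P)"
proof -
  obtain P' where P': "P' \<in> carrier_mat n n" "P * P' = 1\<^sub>m n" "P' * P = 1\<^sub>m n"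
    using invertible_matE[OF P(2,1)] .
  have "transpose_mat P * transpose_mat P' = 1\<^sub>m n"
    using transpose_mult[OF P'(1) P(1)] P'(3) by simp
  moreover have "transpose_mat P' * transpose_mat P = 1\<^sub>m n"
    using transpose_mult[OF P(1) P'(1)] P'(2) by simp
  ultimately show ?thesis
    using P P' by (intro invertible_matI[where n = n and P' = "transpose_mat P'"]) auto
qed

lemma unimodular_equivI:
  assumes "A \<in> carrier_mat nr nc" "P \<in> carrier_mat nr nr" "invertible_mat P"
    "Q \<in> carrier_mat nc nc" "invertible_mat Q" "D = P * A * Q"
  shows "unimodular_equiv A D"
  unfolding unimodular_equiv_def by (rule exI[of _ P], rule exI[of _ Q]) (use assms in auto)

lemma unimodular_equivE:
  assumes "unimodular_equiv A D" "A \<in> carrier_mat nr nc"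
  obtains P Q where "P \<in> carrier_mat nr nr" "invertible_mat P"
    "Q \<in> carrier_mat nc nc" "invertible_mat Q" "D = P * A * Q"
  using assms unfolding unimodular_equiv_def by auto

lemma unimodular_equiv_carrier:
  assumes "unimodular_equiv A D" "A \<in> carrier_mat nr nc"
  shows "D \<in> carrier_mat nr nc"
  using unimodular_equivE[OF assms] assms(2) by (metis mult_carrier_mat)

lemma unimodular_equiv_left:
  assumes A: "A \<in> carrier_mat nr nc" and P: "P \<in> carrier_mat nr nr" "invertible_mat P"
  shows "unimodular_equiv A (P * A)"
proof (rule unimodular_equivI[OF A P one_carrier_mat invertible_one_mat])
  show "P * A = P * A * 1\<^sub>m nc" using A P by simp
qed

lemma unimodular_equiv_refl: "unimodular_equiv A A"
  using unimodular_equiv_left[of A "dim_row A" "dim_col A" "1\<^sub>m (dim_row A)"]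
  by (simp add: invertible_one_mat)

lemma unimodular_equiv_trans:
  assumes AB: "unimodular_equiv A B" and BC: "unimodular_equiv B C"
  shows "unimodular_equiv A C"
proof -
  let ?m = "dim_row A" and ?n = "dim_col A"
  have A: "A \<in> carrier_mat ?m ?n" by simp
  have B: "B \<in> carrier_mat ?m ?n" using unimodular_equiv_carrier[OF AB A] .
  obtain P Q where PQ: "P \<in> carrier_mat ?m ?m" "invertible_mat P"
    "Q \<in> carrier_mat ?n ?n" "invertible_mat Q" "B = P * A * Q"
    using unimodular_equivE[OF AB A] .
  obtain P' Q' where PQ': "P' \<in> carrier_mat ?m ?m" "invertible_mat P'"
    "Q' \<in> carrier_mat ?n ?n" "invertible_mat Q'" "C = P' * B * Q'"
    using unimodular_equivE[OF BC B] .
  have PA: "P * A \<in> carrier_mat ?m ?n" using PQ by auto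
  have "P' * (P * A * Q) = P' * (P * A) * Q"
    by (rule assoc_mult_mat[symmetric, OF PQ'(1) PA PQ(3)])
  also have "P' * (P * A) = P' * P * A"
    by (rule assoc_mult_mat[symmetric, OF PQ'(1) PQ(1) A])
  finally have "C = (P' * P * A * Q) * Q'"
    using PQ(5) PQ'(5) by simp
  also have "\<dots> = P' * P * A * (Q * Q')"
    by (rule assoc_mult_mat[OF mult_carrier_mat[OF mult_carrier_mat[OF PQ'(1) PQ(1)] A] PQ(3) PQ'(3)])
  finally show ?thesis
    by (rule unimodular_equivI[OF A mult_carrier_mat[OF PQ'(1) PQ(1)]
          invertible_mult[OF PQ'(1,2) PQ(1,2)] mult_carrier_mat[OF PQ(3) PQ'(3)]
          invertible_mult[OF PQ(3,4) PQ'(3,4)]])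
qed

lemma unimodular_equiv_transpose:
  assumes "unimodular_equiv A D"
  shows "unimodular_equiv (transpose_mat A) (transpose_mat D)"
proof -
  let ?m = "dim_row A" and ?n = "dim_col A"
  have A: "A \<in> carrier_mat ?m ?n" by simp
  obtain P Q where PQ: "P \<in> carrier_mat ?m ?m" "invertible_mat P"
    "Q \<in> carrier_mat ?n ?n" "invertible_mat Q" "D = P * A * Q"
    using unimodular_equivE[OF assms A] .
  have T: "transpose_mat Q \<in> carrier_mat ?n ?n" "transpose_mat A \<in> carrier_mat ?n ?m"
    "transpose_mat P \<in> carrier_mat ?m ?m"
    by (simp_all only: transpose_carrier_mat PQ A)
  have "transpose_mat D = transpose_mat Q * transpose_mat (P * A)"
    unfolding PQ(5) by (rule transpose_mult[OF mult_carrier_mat[OF PQ(1) A] PQ(3)])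
  also have "transpose_mat (P * A) = transpose_mat A * transpose_mat P"
    by (rule transpose_mult[OF PQ(1) A])
  also have "transpose_mat Q * (transpose_mat A * transpose_mat P)
      = transpose_mat Q * transpose_mat A * transpose_mat P"
    by (rule assoc_mult_mat[symmetric, OF T])
  finally show ?thesis
    by (rule unimodular_equivI[OF T(2,1) invertible_transpose[OF PQ(3,4)] T(3)
          invertible_transpose[OF PQ(1,2)]])
qed

lemma unimodular_equiv_addrow:
  assumes A: "A \<in> carrier_mat nr nc" and kl: "k < nr" "l < nr" "k \<noteq> l"
  shows "unimodular_equiv A (addrow a k l A)"
proof -
  have "invertible_mat (addrow_mat nr a k l)"
    using addrow_mat_inv[OF kl, of a] addrow_mat_inv[OF kl, of "- a"]
    by (intro invertible_matI[of _ nr "addrow_mat nr (- a) k l"]) auto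
  with unimodular_equiv_left[OF A addrow_mat_carrier] show ?thesis
    using addrow_mat[OF A kl(2)] by metis
qed

lemma unimodular_equiv_swaprows:
  assumes A: "A \<in> carrier_mat nr nc" and kl: "k < nr" "l < nr"
  shows "unimodular_equiv A (swaprows k l A)"
proof -
  have "invertible_mat (swaprows_mat nr k l :: int mat)"
    using swaprows_mat_inv[OF kl]
    by (intro invertible_matI[of _ nr "swaprows_mat nr k l"]) auto
  with unimodular_equiv_left[OF A swaprows_mat_carrier] show ?thesis
    using swaprows_mat[OF A kl] by metis
qed

lemma unimodular_equiv_uminus: "unimodular_equiv A (- A)"
proof -
  let ?m = "dim_row A"
  have "(- 1\<^sub>m ?m :: int mat) * (- 1\<^sub>m ?m) = 1\<^sub>m ?m"
    by (simp add: uminus_mult_left_mat uminus_mult_right_mat)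
  then have "invertible_mat (- 1\<^sub>m ?m :: int mat)"
    by (intro invertible_matI[of _ ?m "- 1\<^sub>m ?m"]) auto
  moreover have "- 1\<^sub>m ?m * A = - A"
    by (simp add: uminus_mult_left_mat)
  ultimately show ?thesis
    using unimodular_equiv_left[of A ?m "dim_col A" "- 1\<^sub>m ?m"] by simp
qed

lemma invertible_block_lower:
  fixes C :: "int mat"
  assumes C: "C \<in> carrier_mat n 1"
  shows "invertible_mat (four_block_mat (1\<^sub>m 1) (0\<^sub>m 1 n) C (1\<^sub>m n))"
proof (rule invertible_matI[of _ "1 + n" "four_block_mat (1\<^sub>m 1) (0\<^sub>m 1 n) (- C) (1\<^sub>m n)"])
  have inv: "four_block_mat (1\<^sub>m 1) (0\<^sub>m 1 n) C' (1\<^sub>m n) * four_block_mat (1\<^sub>m 1) (0\<^sub>m 1 n) (- C') (1\<^sub>m n)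
      = 1\<^sub>m (1 + n)" if "C' \<in> carrier_mat n 1" for C' :: "int mat"
  proof -
    have z: "1\<^sub>m 1 * 1\<^sub>m 1 + 0\<^sub>m 1 n * - C' = 1\<^sub>m 1"
      "1\<^sub>m 1 * 0\<^sub>m 1 n + 0\<^sub>m 1 n * 1\<^sub>m n = 0\<^sub>m 1 n"
      "C' * 1\<^sub>m 1 + 1\<^sub>m n * - C' = 0\<^sub>m n 1"
      "C' * 0\<^sub>m 1 n + 1\<^sub>m n * 1\<^sub>m n = 1\<^sub>m n"
      using that by (auto intro!: eq_matI)
    show ?thesis
      using mult_four_block_mat[of "1\<^sub>m 1" 1 1 "0\<^sub>m 1 n" n C' n "1\<^sub>m n" "1\<^sub>m 1" 1 "0\<^sub>m 1 n" n "- C'" "1\<^sub>m n"]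
        that unfolding z four_block_one_mat by simp
  qed
  show "four_block_mat (1\<^sub>m 1) (0\<^sub>m 1 n) C (1\<^sub>m n) * four_block_mat (1\<^sub>m 1) (0\<^sub>m 1 n) (- C) (1\<^sub>m n)
      = 1\<^sub>m (1 + n)"
    by (rule inv[OF C])
  show "four_block_mat (1\<^sub>m 1) (0\<^sub>m 1 n) (- C) (1\<^sub>m n) * four_block_mat (1\<^sub>m 1) (0\<^sub>m 1 n) C (1\<^sub>m n)
      = 1\<^sub>m (1 + n)"
    using inv[of "- C"] C by simp
qed auto

lemma invertible_block_upper:
  fixes R :: "int mat"
  assumes R: "R \<in> carrier_mat 1 n"
  shows "invertible_mat (four_block_mat (1\<^sub>m 1) R (0\<^sub>m n 1) (1\<^sub>m n))"
proof -
  have "four_block_mat (1\<^sub>m 1) R (0\<^sub>m n 1) (1\<^sub>m n)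
      = transpose_mat (four_block_mat (1\<^sub>m 1) (0\<^sub>m 1 n) (transpose_mat R) (1\<^sub>m n))"
    using R by (subst transpose_four_block_mat[of _ 1 1 _ n _ n]) auto
  moreover have "four_block_mat (1\<^sub>m 1) (0\<^sub>m 1 n) (transpose_mat R) (1\<^sub>m n) \<in> carrier_mat (1 + n) (1 + n)"
    by (rule four_block_carrier_mat) auto
  moreover have "transpose_mat R \<in> carrier_mat n 1" using R by simp
  ultimately show ?thesis
    using invertible_transpose[OF _ invertible_block_lower] by metis
qed

lemma unimodular_equiv_block_diag:
  assumes A: "A \<in> carrier_mat nr nc" and AD: "unimodular_equiv A D"
  shows "unimodular_equiv (four_block_mat (m \<cdot>\<^sub>m 1\<^sub>m 1) (0\<^sub>m 1 nc) (0\<^sub>m nr 1) A)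
           (four_block_mat (m \<cdot>\<^sub>m 1\<^sub>m 1) (0\<^sub>m 1 nc) (0\<^sub>m nr 1) D)"
proof -
  let ?b = "\<lambda>n P. four_block_mat (1\<^sub>m 1) (0\<^sub>m 1 n) (0\<^sub>m n 1) (P :: int mat)"
  have inv: "invertible_mat (?b n P)" if P: "P \<in> carrier_mat n n" "invertible_mat P" for n P
  proof -
    obtain P' where P': "P' \<in> carrier_mat n n" "P * P' = 1\<^sub>m n" "P' * P = 1\<^sub>m n"
      using invertible_matE[OF P(2,1)] .
    have "?b n P * ?b n P' = 1\<^sub>m (1 + n)" "?b n P' * ?b n P = 1\<^sub>m (1 + n)"
      using P P' by (subst mult_four_block_mat[of _ 1 1 _ n _ n _ _ 1 _ n]; simp)+
    then show ?thesis using P P' by (intro invertible_matI[of _ "1 + n" "?b n P'"]) auto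
  qed
  obtain P Q where PQ: "P \<in> carrier_mat nr nr" "invertible_mat P"
    "Q \<in> carrier_mat nc nc" "invertible_mat Q" "D = P * A * Q"
    using unimodular_equivE[OF AD A] .
  have PA: "P * A \<in> carrier_mat nr nc" using PQ A by auto
  have "?b nr P * four_block_mat (m \<cdot>\<^sub>m 1\<^sub>m 1) (0\<^sub>m 1 nc) (0\<^sub>m nr 1) A
      = four_block_mat (m \<cdot>\<^sub>m 1\<^sub>m 1) (0\<^sub>m 1 nc) (0\<^sub>m nr 1) (P * A)"
    using PQ A PA by (subst mult_four_block_mat[of _ 1 1 _ nr _ nr _ _ 1 _ nc]) auto
  also have "\<dots> * ?b nc Q = four_block_mat (m \<cdot>\<^sub>m 1\<^sub>m 1) (0\<^sub>m 1 nc) (0\<^sub>m nr 1) D"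
    using PQ A PA by (subst mult_four_block_mat[of _ 1 1 _ nc _ nr _ _ 1 _ nc]) auto
  finally show ?thesis
    using PQ A inv
    by (intro unimodular_equivI[of _ "1 + nr" "1 + nc" "?b nr P" "?b nc Q"]) auto
qed

lemma unimodular_equiv_smult:
  assumes "unimodular_equiv A D"
  shows "unimodular_equiv (m \<cdot>\<^sub>m A) (m \<cdot>\<^sub>m D)"
proof -
  let ?m = "dim_row A" and ?n = "dim_col A"
  have A: "A \<in> carrier_mat ?m ?n" by simp
  obtain P Q where PQ: "P \<in> carrier_mat ?m ?m" "invertible_mat P"
    "Q \<in> carrier_mat ?n ?n" "invertible_mat Q" "D = P * A * Q"
    using unimodular_equivE[OF assms A] .
  have PA: "P * A \<in> carrier_mat ?m ?n" using PQ by auto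
  have "P * (m \<cdot>\<^sub>m A) * Q = m \<cdot>\<^sub>m (P * A) * Q"
    unfolding mult_smult_distrib[OF PQ(1) A] ..
  also have "\<dots> = m \<cdot>\<^sub>m D"
    unfolding PQ(5) by (rule mult_smult_assoc_mat[OF PA PQ(3)])
  finally have "m \<cdot>\<^sub>m D = P * (m \<cdot>\<^sub>m A) * Q" ..
  then show ?thesis using PQ by (intro unimodular_equivI[of _ ?m ?n P Q]) auto
qed

lemma minimal_pivot:
  assumes A: "A \<in> carrier_mat (Suc nr) (Suc nc)" and nz: "A \<noteq> 0\<^sub>m (Suc nr) (Suc nc)"
  obtains B where "unimodular_equiv A B" "B $$ (0,0) > 0"
    "\<And>i j. i < Suc nr \<Longrightarrow> j < Suc nc \<Longrightarrow> B $$ (0,0) dvd B $$ (i,j)"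
proof -
  let ?S = "\<lambda>k. \<exists>B i j. unimodular_equiv A B \<and> i < Suc nr \<and> j < Suc nc \<and> B $$ (i,j) \<noteq> 0
    \<and> k = nat \<bar>B $$ (i,j)\<bar>"
  have "\<exists>i<Suc nr. \<exists>j<Suc nc. A $$ (i,j) \<noteq> 0"
  proof (rule ccontr)
    assume "\<not> ?thesis"
    then have "A = 0\<^sub>m (Suc nr) (Suc nc)" using A by (intro eq_matI) auto
    with nz show False by simp
  qed
  then have "\<exists>k. ?S k" using unimodular_equiv_refl by blast
  then have S: "?S (LEAST k. ?S k)" by (rule LeastI_ex)
  define m where "m = int (LEAST k. ?S k)"
  have min: "m \<le> \<bar>B $$ (i,j)\<bar>"
    if "unimodular_equiv A B" "i < Suc nr" "j < Suc nc" "B $$ (i,j) \<noteq> 0" for B i j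
  proof -
    have "?S (nat \<bar>B $$ (i,j)\<bar>)" using that by blast
    then have "(LEAST k. ?S k) \<le> nat \<bar>B $$ (i,j)\<bar>" by (rule Least_le)
    then show ?thesis unfolding m_def by linarith
  qed
  have carr: "B \<in> carrier_mat (Suc nr) (Suc nc)" if "unimodular_equiv A B" for B
    using unimodular_equiv_carrier[OF that A] .
  note tr = unimodular_equiv_trans
  have tr_swap: "unimodular_equiv A (transpose_mat (swaprows 0 j (transpose_mat B)))"
    if "unimodular_equiv A B" "j < Suc nc" for B j
  proof -
    have "unimodular_equiv (transpose_mat B) (swaprows 0 j (transpose_mat B))"
      using carr[OF that(1)] that(2) by (intro unimodular_equiv_swaprows[of _ "Suc nc" "Suc nr"]) auto
    from unimodular_equiv_transpose[OF this] show ?thesis using tr[OF that(1)] by simp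
  qed
  obtain B0 i0 j0 where B0: "unimodular_equiv A B0" "i0 < Suc nr" "j0 < Suc nc"
    "B0 $$ (i0,j0) \<noteq> 0" "m = \<bar>B0 $$ (i0,j0)\<bar>"
    using S unfolding m_def by auto
  have mpos: "m > 0" using B0 by simp
  define B1 where "B1 = swaprows 0 i0 B0"
  have B1: "unimodular_equiv A B1" "B1 $$ (0,j0) = B0 $$ (i0,j0)"
    using tr[OF B0(1) unimodular_equiv_swaprows[OF carr[OF B0(1)], of 0 i0]] B0 carr[OF B0(1)]
    unfolding B1_def by auto
  define B2 where "B2 = transpose_mat (swaprows 0 j0 (transpose_mat B1))"
  have B2: "unimodular_equiv A B2" "B2 $$ (0,0) = B0 $$ (i0,j0)"
    using tr_swap[OF B1(1) B0(3)] B1 B0(3) carr[OF B1(1)] unfolding B2_def by auto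
  have "\<exists>B. unimodular_equiv A B \<and> B $$ (0,0) = m"
  proof (cases "B0 $$ (i0,j0) > 0")
    case True
    then show ?thesis using B2 B0 by auto
  next
    case False
    then have "(- B2) $$ (0,0) = m" using B2 B0 carr[OF B2(1)] by auto
    then show ?thesis using tr[OF B2(1) unimodular_equiv_uminus] by blast
  qed
  then obtain B where B: "unimodular_equiv A B" "B $$ (0,0) = m" by blast

  have col0: "m dvd C $$ (i,0)"
    if C: "unimodular_equiv A C" "C $$ (0,0) = m" and i: "i < Suc nr" for C i
  proof (cases "i = 0")
    case False
    define C' where "C' = addrow (- (C $$ (i,0) div m)) i 0 C"
    have C': "unimodular_equiv A C'"
      unfolding C'_def using tr[OF C(1) unimodular_equiv_addrow[OF carr[OF C(1)]]] i False by auto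
    have "C' $$ (i,0) = C $$ (i,0) mod m"
      unfolding C'_def using carr[OF C(1)] i C(2)
      by (auto simp: minus_div_mult_eq_mod[symmetric])
    then show ?thesis
      using min[OF C' i, of 0] mpos pos_mod_bound[OF mpos, of "C $$ (i,0)"]
        pos_mod_sign[OF mpos, of "C $$ (i,0)"] by (auto simp: dvd_eq_mod_eq_0)
  qed (use C in simp)
  have row0: "m dvd C $$ (0,j)"
    if C: "unimodular_equiv A C" "C $$ (0,0) = m" and j: "j < Suc nc" for C j
  proof (cases "j = 0")
    case False
    define C' where "C' = transpose_mat (addrow (- (C $$ (0,j) div m)) j 0 (transpose_mat C))"
    have "unimodular_equiv (transpose_mat C) (addrow (- (C $$ (0,j) div m)) j 0 (transpose_mat C))"
      using carr[OF C(1)] j False by (intro unimodular_equiv_addrow[of _ "Suc nc" "Suc nr"]) auto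
    from unimodular_equiv_transpose[OF this] have C': "unimodular_equiv A C'"
      unfolding C'_def using tr[OF C(1)] by simp
    have "C' $$ (0,j) = C $$ (0,j) mod m"
      unfolding C'_def using carr[OF C(1)] j C(2)
      by (auto simp: minus_div_mult_eq_mod[symmetric])
    then show ?thesis
      using min[OF C', of 0 j] j mpos pos_mod_bound[OF mpos, of "C $$ (0,j)"]
        pos_mod_sign[OF mpos, of "C $$ (0,j)"] by (auto simp: dvd_eq_mod_eq_0)
  qed (use C in simp)
  have "m dvd B $$ (i,j)" if ij: "i < Suc nr" "j < Suc nc" for i j
  proof (cases "i = 0")
    case False
    obtain q where q: "B $$ (i,0) = m * q" using col0[OF B ij(1)] by blast
    define C where "C = addrow (1 - q) i 0 B"
    have C: "unimodular_equiv A C"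
      unfolding C_def using tr[OF B(1) unimodular_equiv_addrow[OF carr[OF B(1)]]] ij False by auto
    define D where "D = swaprows 0 i C"
    have D: "unimodular_equiv A D"
      unfolding D_def using tr[OF C unimodular_equiv_swaprows[OF carr[OF C]]] ij by auto
    have Dij: "D $$ (0,j') = (1 - q) * B $$ (0,j') + B $$ (i,j')" if "j' < Suc nc" for j'
      unfolding D_def C_def using carr[OF B(1)] ij that by auto
    have "D $$ (0,0) = m" using Dij[of 0] q B(2) by (simp add: algebra_simps)
    from row0[OF D this ij(2)] have "m dvd (1 - q) * B $$ (0,j) + B $$ (i,j)"
      using Dij[OF ij(2)] by simp
    moreover have "m dvd (1 - q) * B $$ (0,j)" using row0[OF B ij(2)] by simp
    ultimately show ?thesis by (simp add: dvd_add_right_iff)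
  qed (use row0[OF B ij(2)] in simp)
  then show ?thesis using that[of B] B mpos by simp
qed

lemma smith_normal_form_exists:
  fixes A :: "int mat"
  shows "\<exists>D. smith_normal_form A D"
proof -
  have "A \<in> carrier_mat nr nc \<Longrightarrow> \<exists>D. smith_normal_form A D" for nr nc and A :: "int mat"
  proof (induction nr arbitrary: nc A)
    case 0
    then have "smith_normal_form A A"
      by (auto simp: smith_normal_form_def unimodular_equiv_refl diagonal_mat_def)
    then show ?case by blast
  next
    case (Suc nr)
    show ?case
    proof (cases "nc = 0 \<or> A = 0\<^sub>m (Suc nr) nc")
      case True
      then have "smith_normal_form A A" using Suc.prems
        by (auto simp: smith_normal_form_def unimodular_equiv_refl diagonal_mat_def)
      then show ?thesis by blast
    next
      case False
      then obtain k where nc: "nc = Suc k" by (cases nc) auto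
      obtain B where B: "unimodular_equiv A B" "B $$ (0,0) > 0"
        "\<And>i j. i < Suc nr \<Longrightarrow> j < Suc k \<Longrightarrow> B $$ (0,0) dvd B $$ (i,j)"
        using minimal_pivot[of A nr k] Suc.prems False unfolding nc by blast
      have Bc: "B \<in> carrier_mat (Suc nr) (Suc k)"
        using unimodular_equiv_carrier[OF B(1)] Suc.prems nc by simp
      define m where "m = B $$ (0,0)"
      define R where "R = mat 1 k (\<lambda>(i, j). B $$ (0, Suc j) div m)"
      define C where "C = mat nr 1 (\<lambda>(i, j). B $$ (Suc i, 0) div m)"
      define M where "M = mat nr k (\<lambda>(i, j). B $$ (Suc i, Suc j) div m)"
      define G where "G = M + - C * R"
      have carr: "R \<in> carrier_mat 1 k" "C \<in> carrier_mat nr 1" "M \<in> carrier_mat nr k"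
        "G \<in> carrier_mat nr k"
        unfolding R_def C_def M_def G_def by auto
      have B_block: "B = four_block_mat (m \<cdot>\<^sub>m 1\<^sub>m 1) (m \<cdot>\<^sub>m R) (m \<cdot>\<^sub>m C) (m \<cdot>\<^sub>m M)"
      proof (rule eq_matI, goal_cases)
        case (1 i j)
        then have "i < Suc nr" "j < Suc k" using carr by auto
        then show ?case using B(3)[of i j] Bc
          by (cases i; cases j) (auto simp: R_def C_def M_def m_def)
      qed (use Bc carr in auto)
      let ?P = "four_block_mat (1\<^sub>m 1) (0\<^sub>m 1 nr) (- C) (1\<^sub>m nr)"
      let ?Q = "four_block_mat (1\<^sub>m 1) (- R) (0\<^sub>m k 1) (1\<^sub>m k)"
      have P: "1\<^sub>m 1 * (m \<cdot>\<^sub>m 1\<^sub>m 1) + 0\<^sub>m 1 nr * (m \<cdot>\<^sub>m C) = m \<cdot>\<^sub>m 1\<^sub>m 1"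
        "1\<^sub>m 1 * (m \<cdot>\<^sub>m R) + 0\<^sub>m 1 nr * (m \<cdot>\<^sub>m M) = m \<cdot>\<^sub>m R"
        "- C * (m \<cdot>\<^sub>m 1\<^sub>m 1) + 1\<^sub>m nr * (m \<cdot>\<^sub>m C) = 0\<^sub>m nr 1"
        "- C * (m \<cdot>\<^sub>m R) + 1\<^sub>m nr * (m \<cdot>\<^sub>m M) = m \<cdot>\<^sub>m G"
        unfolding G_def using carr
        by (auto intro!: eq_matI simp: scalar_prod_def algebra_simps)
      have Q: "(m \<cdot>\<^sub>m 1\<^sub>m 1) * 1\<^sub>m 1 + (m \<cdot>\<^sub>m R) * 0\<^sub>m k 1 = m \<cdot>\<^sub>m 1\<^sub>m 1"
        "(m \<cdot>\<^sub>m 1\<^sub>m 1) * - R + (m \<cdot>\<^sub>m R) * 1\<^sub>m k = 0\<^sub>m 1 k"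
        "0\<^sub>m nr 1 * 1\<^sub>m 1 + (m \<cdot>\<^sub>m G) * 0\<^sub>m k 1 = 0\<^sub>m nr 1"
        "0\<^sub>m nr 1 * - R + (m \<cdot>\<^sub>m G) * 1\<^sub>m k = m \<cdot>\<^sub>m G"
        using carr by (auto intro!: eq_matI simp: scalar_prod_def)
      have "?P * B = four_block_mat (m \<cdot>\<^sub>m 1\<^sub>m 1) (m \<cdot>\<^sub>m R) (0\<^sub>m nr 1) (m \<cdot>\<^sub>m G)"
        unfolding B_block
        by (subst mult_four_block_mat[of _ 1 1 _ nr _ nr _ _ 1 _ k])
          (use carr in \<open>auto simp only: P uminus_carrier_iff_mat smult_carrier_mat one_carrier_mat zero_carrier_mat\<close>)
      also have "\<dots> * ?Q = four_block_mat (m \<cdot>\<^sub>m 1\<^sub>m 1) (0\<^sub>m 1 k) (0\<^sub>m nr 1) (m \<cdot>\<^sub>m G)"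
        by (subst mult_four_block_mat[of _ 1 1 _ k _ nr _ _ 1 _ k])
          (use carr in \<open>auto simp only: Q uminus_carrier_iff_mat smult_carrier_mat one_carrier_mat zero_carrier_mat\<close>)
      finally have BG: "unimodular_equiv B
          (four_block_mat (m \<cdot>\<^sub>m 1\<^sub>m 1) (0\<^sub>m 1 k) (0\<^sub>m nr 1) (m \<cdot>\<^sub>m G))"
        using invertible_block_lower[of "- C" nr] invertible_block_upper[of "- R" k] carr Bc
        by (intro unimodular_equivI[of B "1 + nr" "1 + k" ?P ?Q]) auto
      obtain D where D: "smith_normal_form G D" using Suc.IH[OF carr(4)] by blast
      then have GD: "unimodular_equiv G D" by (simp add: smith_normal_form_def)
      have Dc: "D \<in> carrier_mat nr k" using unimodular_equiv_carrier[OF GD carr(4)] .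
      let ?D = "four_block_mat (m \<cdot>\<^sub>m 1\<^sub>m 1) (0\<^sub>m 1 k) (0\<^sub>m nr 1) (m \<cdot>\<^sub>m D)"
      have "unimodular_equiv A ?D"
        using unimodular_equiv_trans[OF unimodular_equiv_trans[OF B(1) BG]
            unimodular_equiv_block_diag[OF _ unimodular_equiv_smult[OF GD]]] carr by simp
      moreover have "diagonal_mat ?D"
        using D Dc unfolding smith_normal_form_def diagonal_mat_def by auto
      moreover have "?D $$ (i, i) \<ge> 0" if "i < dim_row ?D" "i < dim_col ?D" for i
        using D Dc that B(2) unfolding smith_normal_form_def m_def by (cases i) auto
      moreover have "?D $$ (i, i) dvd ?D $$ (Suc i, Suc i)"
        if "Suc i < dim_row ?D" "Suc i < dim_col ?D" for i
        using D Dc that unfolding smith_normal_form_def by (cases i) auto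
      ultimately have "smith_normal_form A ?D" by (simp add: smith_normal_form_def)
      then show ?thesis by blast
    qed
  qed
  then show ?thesis by (meson carrier_matI)
qed

lemma invariant_factors_exist: "\<exists>ds. invariant_factors A ds"
  using smith_normal_form_exists unfolding invariant_factors_def by blast

end

theory Submission
  imports Defs "Jordan_Normal_Form.Determinant" "HOL-Number_Theory.Cong"
begin

text \<open>
  Let \<open>Y\<close> be the part of \<open>X\<close> that comes from the edges of a single color. The oddness of the
  bicolor cycles makes this part anticommute with the remaining colors, which gives the integral
  identity \<open>X Y\<^sup>T + Y X\<^sup>T = 2 I\<close> (\<open>boson_fermion_mat_color_anticommute\<close>). Over the field with
  \<open>p\<close> elements, where \<open>2\<close> is invertible, it bounds the size \<open>n\<close> of \<open>X\<close> by
  \<open>rank X + rank X\<^sup>T = 2 rank X\<close>. Hence \<open>X\<close> has rank at least \<open>n / 2\<close> modulo \<open>p\<close>, where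
  \<open>n = #V / 2\<close>; as the rank modulo \<open>p\<close> is the number of invariant factors prime to \<open>p\<close>, and
  these form an initial segment by the divisibility chain, this is the claim for \<open>X\<close>.

  The same reasoning works for every square matrix \<open>A\<close> for which there is an \<open>S\<close> such that
  \<open>A S + (A S)\<^sup>T\<close> is invertible modulo \<open>p\<close>. For the Laplacian, take for \<open>S\<close> the symmetric matrix with
  off-diagonal blocks \<open>Y\<close> and \<open>Y\<^sup>T\<close>: the diagonal blocks of \<open>L S + (L S)\<^sup>T\<close> are
  \<open>- 2 I\<close>, and its off-diagonal blocks are multiples of \<open>N\<close>, so they vanish modulo \<open>p\<close>.

  The rank argument is carried out with integer determinants
  (\<open>not_dvd_invariant_factor_if_symmetrization\<close>): if too many invariant factors were divisible by
  \<open>p\<close>, then after a unimodular congruence the symmetrization would have a block of zeros modulo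
  \<open>p\<close> that is too large for a matrix with determinant prime to \<open>p\<close>.
\<close>

section \<open>Determinants modulo a number\<close>

text \<open>
  In the Leibniz formula, a permutation cannot map the more than \<open>m / 2\<close> indices \<open>\<ge> i\<close> into the
  fewer than \<open>m / 2\<close> indices \<open>< i\<close>; so each term has a factor from the block.
\<close>

lemma dvd_det_if_large_zero_block:
  fixes H :: "int mat"
  assumes H: "H \<in> carrier_mat m m" and i: "2 * i < m"
    and block: "\<And>j k. i \<le> j \<Longrightarrow> j < m \<Longrightarrow> i \<le> k \<Longrightarrow> k < m \<Longrightarrow> q dvd H $$ (j, k)"
  shows "q dvd det H"
proof -
  have "q dvd signof \<pi> * (\<Prod>j = 0..<m. H $$ (j, \<pi> j))" if \<pi>: "\<pi> permutes {0..<m}" for \<pi>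
  proof -
    have "\<exists>j. i \<le> j \<and> j < m \<and> i \<le> \<pi> j"
    proof (rule ccontr)
      assume "\<not> ?thesis"
      then have "\<pi> ` {i..<m} \<subseteq> {0..<i}" by force
      then have "card {i..<m} \<le> card {0..<i}"
        using permutes_inj_on[OF \<pi>] by (meson card_inj_on_le finite_atLeastLessThan)
      then show False using i by simp
    qed
    then obtain j where j: "i \<le> j" "j < m" "i \<le> \<pi> j" by blast
    moreover have "\<pi> j < m" using permutes_in_image[OF \<pi>, of j] j by simp
    ultimately have "q dvd H $$ (j, \<pi> j)" by (intro block)
    moreover have "H $$ (j, \<pi> j) dvd (\<Prod>j = 0..<m. H $$ (j, \<pi> j))"
      using j by (intro dvd_prodI) auto
    ultimately show ?thesis by (meson dvd_mult dvd_trans)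
  qed
  then show ?thesis unfolding det_def'[OF H] by (intro dvd_sum) auto
qed

lemma det_cong:
  fixes A B :: "int mat"
  assumes A: "A \<in> carrier_mat m m" and B: "B \<in> carrier_mat m m"
    and "\<And>i j. i < m \<Longrightarrow> j < m \<Longrightarrow> [A $$ (i, j) = B $$ (i, j)] (mod q)"
  shows "[det A = det B] (mod q)"
  unfolding det_def'[OF A] det_def'[OF B]
proof (intro cong_sum cong_mult cong_prod cong_refl)
  fix \<pi> i assume "\<pi> \<in> {\<pi>. \<pi> permutes {0..<m}}" "i \<in> {0..<m}"
  then show "[A $$ (i, \<pi> i) = B $$ (i, \<pi> i)] (mod q)"
    using assms(3)[of i "\<pi> i"] permutes_in_image[of \<pi> "{0..<m}" i] by auto
qed


section \<open>Invariant factors of a matrix with invertible symmetrization\<close>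

text \<open>
  Write \<open>D = P A Q\<close> for the Smith normal form and \<open>T\<close> for the symmetrization of \<open>A S\<close>. Then
  \<open>P (A S) P\<^sup>T = D K\<close> for an integer matrix \<open>K\<close>, so \<open>P T P\<^sup>T = D K + (D K)\<^sup>T\<close>. If \<open>q\<close>
  divides the \<open>i\<close>th invariant factor, it divides all later ones, hence all rows of \<open>D K\<close> from \<open>i\<close>
  on. Therefore \<open>P T P\<^sup>T\<close> is zero modulo \<open>q\<close> on the block of indices \<open>\<ge> i\<close>: these
  indices span a subspace that is isotropic for \<open>T\<close> and has more than half of the full dimension.
\<close>

lemma not_dvd_invariant_factor_if_symmetrization:
  fixes A S :: "int mat"
  assumes A: "A \<in> carrier_mat m m" and S: "S \<in> carrier_mat m m"
    and det: "\<not> q dvd det (A * S + transpose_mat (A * S))"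
    and ds: "invariant_factors A ds" and i: "2 * i < m"
  shows "\<not> q dvd ds ! i"
proof
  assume q: "q dvd ds ! i"
  obtain D where D: "smith_normal_form A D" "ds = diag_mat D"
    using ds unfolding invariant_factors_def by blast
  then have "unimodular_equiv A D" by (simp add: smith_normal_form_def)
  then obtain P Q where P: "P \<in> carrier_mat m m" "invertible_mat P"
    and Q: "Q \<in> carrier_mat m m" "invertible_mat Q" and DPQ: "D = P * A * Q"
    using unimodular_equivE[OF _ A] by metis
  obtain P' where P': "P' \<in> carrier_mat m m" "P * P' = 1\<^sub>m m"
    using invertible_matE[OF P(2,1)] by metis
  obtain Q' where Q': "Q' \<in> carrier_mat m m" "Q * Q' = 1\<^sub>m m"
    using invertible_matE[OF Q(2,1)] by metis
  have Dc: "D \<in> carrier_mat m m" using DPQ P Q A by auto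
  have "q dvd D $$ (j, j)" if "i \<le> j" "j < m" for j
    using that
  proof (induction j rule: dec_induct)
    case base
    then show ?case using q D(2) Dc i by (simp add: diag_mat_def)
  next
    case (step j)
    have "D $$ (j, j) dvd D $$ (Suc j, Suc j)"
      using D(1) Dc step.prems unfolding smith_normal_form_def by auto
    then show ?case using step by auto
  qed
  moreover have "diagonal_mat D" using D(1) by (simp add: smith_normal_form_def)
  ultimately have row: "q dvd D $$ (j, k)" if "i \<le> j" "j < m" "k < m" for j k
    using that Dc by (cases "j = k") (auto simp: diagonal_mat_def)
  define K where "K = Q' * (S * transpose_mat P)"
  have K: "K \<in> carrier_mat m m" using Q' S P unfolding K_def by auto
  have DK: "D * K = P * (A * S) * transpose_mat P"
  proof -
    have T: "transpose_mat P \<in> carrier_mat m m" using P by simp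
    have PA: "P * A \<in> carrier_mat m m" using P A by auto
    have ST: "S * transpose_mat P \<in> carrier_mat m m" using S T by auto
    have "D * K = P * A * (Q * K)"
      unfolding DPQ by (rule assoc_mult_mat[OF PA Q(1) K])
    also have "Q * K = Q * Q' * (S * transpose_mat P)"
      unfolding K_def by (rule assoc_mult_mat[symmetric, OF Q(1) Q'(1) ST])
    also have "\<dots> = S * transpose_mat P" unfolding Q'(2) by (rule left_mult_one_mat[OF ST])
    also have "P * A * (S * transpose_mat P) = P * A * S * transpose_mat P"
      by (rule assoc_mult_mat[symmetric, OF PA S T])
    also have "P * A * S = P * (A * S)" by (rule assoc_mult_mat[OF P(1) A S])
    finally show ?thesis .
  qed
  let ?T = "A * S + transpose_mat (A * S)"
  have c: "A * S \<in> carrier_mat m m" "P * (A * S) \<in> carrier_mat m m"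
    "transpose_mat (A * S) \<in> carrier_mat m m" "transpose_mat P \<in> carrier_mat m m"
    "?T \<in> carrier_mat m m" "P * ?T \<in> carrier_mat m m"
    using A S P by (auto simp del: transpose_mult)
  have H: "P * ?T * transpose_mat P = D * K + transpose_mat (D * K)"
  proof -
    have "transpose_mat (D * K) = P * transpose_mat (P * (A * S))"
      unfolding DK using transpose_mult[OF c(2,4)] by simp
    also have "transpose_mat (P * (A * S)) = transpose_mat (A * S) * transpose_mat P"
      by (rule transpose_mult[OF P(1) c(1)])
    also have "P * (transpose_mat (A * S) * transpose_mat P)
        = P * transpose_mat (A * S) * transpose_mat P"
      by (rule assoc_mult_mat[symmetric, OF P(1) c(3,4)])
    finally have "D * K + transpose_mat (D * K)
        = (P * (A * S) + P * transpose_mat (A * S)) * transpose_mat P"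
      unfolding DK using add_mult_distrib_mat[OF c(2) mult_carrier_mat[OF P(1) c(3)] c(4)] by simp
    also have "P * (A * S) + P * transpose_mat (A * S) = P * ?T"
      by (rule mult_add_distrib_mat[symmetric, OF P(1) c(1,3)])
    finally show ?thesis ..
  qed
  have "q dvd (D * K) $$ (j, k)" if "i \<le> j" "j < m" "k < m" for j k
    using that Dc K row by (auto simp: scalar_prod_def intro!: dvd_sum)
  then have "q dvd det (P * ?T * transpose_mat P)"
    unfolding H using Dc K i by (intro dvd_det_if_large_zero_block[of _ m i]) auto
  also have "det (P * ?T * transpose_mat P) = det P * det ?T * det P"
    using det_mult[OF c(6,4)] det_mult[OF P(1) c(5)] det_transpose[OF P(1)] by simp
  finally have "q dvd det P * det ?T * det P" .
  \<comment> \<open>\<open>det P\<close> is a unit; multiplying by the square of its inverse leaves \<open>det T\<close>.\<close>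
  then have "q dvd det P * det ?T * det P * (det P' * det P')" by simp
  also have "\<dots> = (det P * det P') * (det P * det P') * det ?T" by simp
  also have "det P * det P' = 1"
    using det_mult[OF P(1) P'(1)] P'(2) by simp
  finally show False using det by simp
qed


section \<open>Sign relations in bicolor cycles\<close>

lemma four_cycle_if_path:
  assumes "four_cycle C" "{v, w} \<in> C" "{w, x} \<in> C" "{x, y} \<in> C" "distinct [v, w, x, y]"
  shows "C = {{v, w}, {w, x}, {x, y}, {y, v}}"
proof -
  obtain a b c d where d: "distinct [a, b, c, d]" and C: "C = {{a, b}, {b, c}, {c, d}, {d, a}}"
    using assms(1) unfolding four_cycle_def by blast
  have "(v = a \<and> w = b) \<or> (v = b \<and> w = a) \<or> (v = b \<and> w = c) \<or> (v = c \<and> w = b)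
      \<or> (v = c \<and> w = d) \<or> (v = d \<and> w = c) \<or> (v = d \<and> w = a) \<or> (v = a \<and> w = d)"
    using assms(2) unfolding C by (simp add: doubleton_eq_iff)
  then obtain x' y' where d': "distinct [v, w, x', y']"
    and C': "C = {{v, w}, {w, x'}, {x', y'}, {y', v}}"
  proof (elim disjE conjE, goal_cases)
    case 1 then show ?case using d C by (intro 1(1)[of c d]) (auto simp: insert_commute)
  next
    case 2 then show ?case using d C by (intro 2(1)[of d c]) (auto simp: insert_commute)
  next
    case 3 then show ?case using d C by (intro 3(1)[of d a]) (auto simp: insert_commute)
  next
    case 4 then show ?case using d C by (intro 4(1)[of a d]) (auto simp: insert_commute)
  next
    case 5 then show ?case using d C by (intro 5(1)[of a b]) (auto simp: insert_commute)
  next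
    case 6 then show ?case using d C by (intro 6(1)[of b a]) (auto simp: insert_commute)
  next
    case 7 then show ?case using d C by (intro 7(1)[of b c]) (auto simp: insert_commute)
  next
    case 8 then show ?case using d C by (intro 8(1)[of c b]) (auto simp: insert_commute)
  qed
  have "x = x'"
    using assms(3,5) d' unfolding C' by (auto simp: doubleton_eq_iff)
  moreover have "y = y'"
    using assms(4,5) d' \<open>x = x'\<close> unfolding C' by (auto simp: doubleton_eq_iff)
  ultimately show ?thesis using C' by simp
qed

lemma prod_signs:
  fixes s :: "'a \<Rightarrow> int"
  assumes "finite C" "\<And>e. e \<in> C \<Longrightarrow> s e \<in> {-1, 1}"
  shows "prod s C = (-1) ^ card {e \<in> C. s e = -1}"
proof -
  have "prod s C = (\<Prod>e\<in>C. if s e = -1 then -1 else 1)"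
    using assms(2) by (intro prod.cong) auto
  also have "\<dots> = (\<Prod>e\<in>{e \<in> C. s e = -1}. -1)"
    by (rule prod.inter_filter[OF assms(1), symmetric])
  finally show ?thesis by simp
qed

context adinkra
begin

text \<open>
  Exchanging bosons and fermions transposes \<open>X\<close>, so each fact about the rows of \<open>X\<close> yields one
  about its columns.
\<close>

lemma adinkra_swap: "adinkra N V F B E \<mu> \<chi> h"
proof unfold_locales
  show "\<exists>b\<in>F. \<exists>f\<in>B. e = {b, f}" if "e \<in> E" for e
    using bipartite[OF that] by (auto simp: insert_commute)
qed (use N_pos V_nonempty bipartition colors regular one_of_each_color bicolor_cycles
    odd_dashed height in auto)

lemma neighbor_of_color:
  assumes b: "b \<in> B" and c: "c < N"
  obtains f where "f \<in> F" "\<And>f'. {b, f'} \<in> {e \<in> E. \<chi> e = c} \<longleftrightarrow> f' = f"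
proof -
  have "b \<in> V" using b bipartition by auto
  from one_of_each_color[OF this c] obtain e where e: "e \<in> E" "b \<in> e" "\<chi> e = c"
    and uniq: "\<And>e'. e' \<in> E \<Longrightarrow> b \<in> e' \<Longrightarrow> \<chi> e' = c \<Longrightarrow> e' = e" by blast
  obtain b' f where f: "b' \<in> B" "f \<in> F" "e = {b', f}" using bipartite[OF e(1)] by blast
  then have "b' = b" using e(2) b bipartition by auto
  with f e have bf: "{b, f} \<in> E" "\<chi> {b, f} = c" by auto
  show ?thesis
  proof (rule that[OF f(2)])
    show "{b, f'} \<in> {e \<in> E. \<chi> e = c} \<longleftrightarrow> f' = f" for f'
      using bf uniq[of "{b, f'}"] uniq[OF bf(1) _ bf(2)] by (auto simp: doubleton_eq_iff)
  qed
qed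

text \<open>
  If the color-\<open>c\<close> edges at \<open>a\<close> and \<open>b\<close> are joined by an edge \<open>a y\<close>, then its color differs from
  \<open>c\<close>, and the three edges \<open>x a\<close>, \<open>a y\<close>, \<open>y b\<close> lie on one bicolor cycle. The fourth side of that
  cycle must be \<open>b x\<close>, and oddness makes the product of the four signs \<open>-1\<close>.
\<close>

lemma bicolor_square:
  assumes ab: "a \<in> B" "b \<in> B" "a \<noteq> b" and xy: "x \<in> F" "y \<in> F" and c: "c < N"
    and ax: "{a, x} \<in> E" "\<chi> {a, x} = c" and bY: "{b, y} \<in> E" "\<chi> {b, y} = c"
    and ay: "{a, y} \<in> E"
  shows "{b, x} \<in> E \<and> \<mu> {a, x} * \<mu> {a, y} * \<mu> {b, y} * \<mu> {b, x} = -1"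
proof -
  have VF: "a \<in> V" "b \<in> V" "y \<in> V" and neq: "a \<noteq> x" "a \<noteq> y" "b \<noteq> x" "b \<noteq> y"
    using ab xy bipartition by auto
  have "\<chi> {a, y} \<noteq> c"
  proof
    assume "\<chi> {a, y} = c"
    then have "{a, y} = {b, y}"
      using one_of_each_color[OF VF(3) c] ay bY by blast
    then show False using ab by (auto simp: doubleton_eq_iff)
  qed
  then have "x \<noteq> y" using ax by auto
  define d where "d = \<chi> {a, y}"
  have d: "d < N" "c \<noteq> d" using colors[OF ay] \<open>\<chi> {a, y} \<noteq> c\<close> unfolding d_def by auto
  let ?S = "bicolor_edges E \<chi> c d"
  have S: "{x, a} \<in> ?S" "{a, y} \<in> ?S" "{y, b} \<in> ?S"
    using ax bY ay unfolding bicolor_edges_def d_def by (auto simp: insert_commute)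
  obtain \<C> where \<C>: "\<forall>C\<in>\<C>. four_cycle C"
    "\<forall>C\<in>\<C>. \<forall>D\<in>\<C>. C \<noteq> D \<longrightarrow> \<Union>C \<inter> \<Union>D = {}" "?S = \<Union>\<C>"
    using bicolor_cycles[OF c d] unfolding disjoint_union_of_four_cycles_def
    by (elim exE conjE)
  have same: "C = D" if "C \<in> \<C>" "D \<in> \<C>" "e \<in> C" "e' \<in> D" "v \<in> e" "v \<in> e'" for C D e e' v
    using bspec[OF bspec[OF \<C>(2) that(1)] that(2)] that(3-6) by blast
  obtain C where C: "C \<in> \<C>" "{a, y} \<in> C" using S \<C>(3) by blast
  have "{x, a} \<in> C" "{y, b} \<in> C"
    using S(1,3) same[OF C(1) _ C(2)] unfolding \<C>(3) by blast+
  with C have C_eq: "C = {{x, a}, {a, y}, {y, b}, {b, x}}"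
    using ab neq \<open>x \<noteq> y\<close> by (intro four_cycle_if_path bspec[OF \<C>(1)]) auto
  have CS: "C \<subseteq> ?S" using C(1) \<C>(3) by blast
  then have CE: "C \<subseteq> E" unfolding bicolor_edges_def by blast
  have "odd (card {e \<in> C. \<mu> e = -1})"
    by (rule odd_dashed[OF c d CS bspec[OF \<C>(1) C(1)]])
  moreover have "prod \<mu> C = (-1) ^ card {e \<in> C. \<mu> e = -1}"
    using signature CE by (intro prod_signs) (auto simp: C_eq)
  ultimately have "prod \<mu> C = -1" by simp
  moreover have "prod \<mu> C = \<mu> {x, a} * (\<mu> {a, y} * (\<mu> {y, b} * \<mu> {b, x}))"
  proof -
    have "{x, a} \<notin> {{a, y}, {y, b}, {b, x}}" "{a, y} \<notin> {{y, b}, {b, x}}" "{y, b} \<notin> {{b, x}}"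
      using ab neq \<open>x \<noteq> y\<close> by (auto simp: doubleton_eq_iff)
    then show ?thesis unfolding C_eq by simp
  qed
  ultimately show ?thesis
    using CE unfolding C_eq by (simp add: insert_commute mult.assoc)
qed

text \<open>
  Each row \<open>k\<close> of \<open>Y\<close> has a single nonzero entry, in the column \<open>\<phi> k\<close> of the color-\<open>c\<close> neighbor of
  the \<open>k\<close>th boson. So the \<open>(i, k)\<close> entry of the sum consists of the two products over opposite sides of
  the square through the \<open>i\<close>th and \<open>k\<close>th bosons and their color-\<open>c\<close> neighbors. For \<open>i \<noteq> k\<close> both
  vanish or, by \<open>bicolor_square\<close>, they have opposite signs; on the diagonal both are \<open>1\<close>.
\<close>

lemma boson_fermion_mat_color_anticommute:
  fixes bs fs :: "'v list"
  defines "X \<equiv> boson_fermion_mat E \<mu> bs fs"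
  assumes bs: "distinct bs" "set bs = B" and fs: "distinct fs" "set fs = F" and c: "c < N"
  defines "Y \<equiv> boson_fermion_mat {e \<in> E. \<chi> e = c} \<mu> bs fs"
  shows "X * transpose_mat Y + Y * transpose_mat X = 2 \<cdot>\<^sub>m 1\<^sub>m (length bs)"
proof -
  let ?n = "length bs" and ?m = "length fs"
  let ?M = "\<lambda>v w. if {v, w} \<in> E then \<mu> {v, w} else 0"
  have carr: "X \<in> carrier_mat ?n ?m" "Y \<in> carrier_mat ?n ?m"
    unfolding X_def Y_def boson_fermion_mat_def by auto
  have X: "X $$ (i, j) = ?M (bs ! i) (fs ! j)" if "i < ?n" "j < ?m" for i j
    using that unfolding X_def boson_fermion_mat_def by simp
  let ?P = "\<lambda>k l. l < ?m \<and> (\<forall>j<?m. {bs ! k, fs ! j} \<in> {e \<in> E. \<chi> e = c} \<longleftrightarrow> j = l)"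
  have "\<exists>l. ?P k l" if "k < ?n" for k
  proof -
    have "bs ! k \<in> B" using that bs by auto
    from neighbor_of_color[OF this c] obtain f where
      f: "f \<in> F" "\<And>f'. {bs ! k, f'} \<in> {e \<in> E. \<chi> e = c} \<longleftrightarrow> f' = f" by metis
    obtain l where "l < ?m" "f = fs ! l" using f(1) fs by (metis in_set_conv_nth)
    then show ?thesis using f(2) fs by (auto simp: nth_eq_iff_index_eq)
  qed
  then have "\<forall>k. \<exists>l. k < ?n \<longrightarrow> ?P k l" by blast
  from choice[OF this] obtain \<phi> where "\<forall>k. k < ?n \<longrightarrow> ?P k (\<phi> k)" ..
  then have \<phi>: "\<And>k. k < ?n \<Longrightarrow> \<phi> k < ?m"
    and \<phi>_iff: "\<And>k j. k < ?n \<Longrightarrow> j < ?m \<Longrightarrow> {bs ! k, fs ! j} \<in> {e \<in> E. \<chi> e = c} \<longleftrightarrow> j = \<phi> k"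
    by blast+
  have Y: "Y $$ (k, j) = (if j = \<phi> k then \<mu> {bs ! k, fs ! \<phi> k} else 0)" if "k < ?n" "j < ?m" for k j
    using that \<phi>_iff[OF that] unfolding Y_def boson_fermion_mat_def by simp
  have edge: "{bs ! k, fs ! \<phi> k} \<in> E" "\<chi> {bs ! k, fs ! \<phi> k} = c" if "k < ?n" for k
    using \<phi>_iff[OF that \<phi>[OF that]] by auto
  have XY: "(\<Sum>j = 0..<?m. X $$ (i, j) * Y $$ (k, j))
      = ?M (bs ! i) (fs ! \<phi> k) * \<mu> {bs ! k, fs ! \<phi> k}" if "i < ?n" "k < ?n" for i k
  proof -
    have "(\<Sum>j = 0..<?m. X $$ (i, j) * Y $$ (k, j))
        = (\<Sum>j = 0..<?m. if j = \<phi> k then X $$ (i, \<phi> k) * \<mu> {bs ! k, fs ! \<phi> k} else 0)"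
      using that Y by (intro sum.cong) auto
    also have "\<dots> = X $$ (i, \<phi> k) * \<mu> {bs ! k, fs ! \<phi> k}"
      using \<phi>[OF that(2)] by (simp add: sum.delta)
    finally show ?thesis using X that \<phi> by simp
  qed
  show ?thesis
  proof (rule eq_matI)
    fix i k assume "i < dim_row (2 \<cdot>\<^sub>m 1\<^sub>m ?n :: int mat)" "k < dim_col (2 \<cdot>\<^sub>m 1\<^sub>m ?n :: int mat)"
    then have ik: "i < ?n" "k < ?n" by auto
    let ?a = "bs ! i" and ?b = "bs ! k" and ?x = "fs ! \<phi> i" and ?y = "fs ! \<phi> k"
    have mem: "?a \<in> B" "?b \<in> B" "?x \<in> F" "?y \<in> F" using ik \<phi> bs fs by auto
    have sgn: "\<mu> e * \<mu> e = 1" if "e \<in> E" for e using signature[OF that] by auto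
    have "(X * transpose_mat Y + Y * transpose_mat X) $$ (i, k)
        = (\<Sum>j = 0..<?m. X $$ (i, j) * Y $$ (k, j)) + (\<Sum>j = 0..<?m. X $$ (k, j) * Y $$ (i, j))"
      using carr ik by (auto simp: scalar_prod_def mult.commute)
    also have "\<dots> = ?M ?a ?y * \<mu> {?b, ?y} + ?M ?b ?x * \<mu> {?a, ?x}"
      using XY ik by simp
    also have "\<dots> = (2 \<cdot>\<^sub>m 1\<^sub>m ?n) $$ (i, k)"
    proof (cases "i = k")
      case True
      then show ?thesis using ik edge[OF ik(1)] sgn by simp
    next
      case False
      then have ab: "?a \<noteq> ?b" using ik bs by (simp add: nth_eq_iff_index_eq)
      have "{?a, ?y} \<in> E \<longleftrightarrow> {?b, ?x} \<in> E"
        using bicolor_square[OF mem(1,2) ab mem(3,4) c edge[OF ik(1)] edge[OF ik(2)]]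
          bicolor_square[OF mem(2,1) ab[symmetric] mem(4,3) c edge[OF ik(2)] edge[OF ik(1)]]
        by blast
      moreover have "\<mu> {?a, ?y} * \<mu> {?b, ?y} + \<mu> {?b, ?x} * \<mu> {?a, ?x} = 0" if "{?a, ?y} \<in> E"
      proof -
        have sq: "{?b, ?x} \<in> E" "\<mu> {?a, ?x} * \<mu> {?a, ?y} * \<mu> {?b, ?y} * \<mu> {?b, ?x} = -1"
          using bicolor_square[OF mem(1,2) ab mem(3,4) c edge[OF ik(1)] edge[OF ik(2)] that] by auto
        show ?thesis
          using sq(2) signature[OF that] signature[OF sq(1)] signature[OF edge(1)[OF ik(1)]]
            signature[OF edge(1)[OF ik(2)]] by auto
      qed
      ultimately show ?thesis using ik False by auto
    qed
    finally show "(X * transpose_mat Y + Y * transpose_mat X) $$ (i, k) = (2 \<cdot>\<^sub>m 1\<^sub>m ?n) $$ (i, k)" .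
  qed (use carr in auto)
qed

text \<open>
  The edges of one color form a perfect matching. Together with \<open>adinkra_swap\<close> this shows that \<open>X\<close>
  is square.
\<close>

lemma card_bosons_le_card_fermions: "card B \<le> card F"
proof -
  have "\<exists>f\<in>F. {b, f} \<in> {e \<in> E. \<chi> e = 0}" if "b \<in> B" for b
    using neighbor_of_color[OF that, of 0] N_pos by (metis less_eq_Suc_le One_nat_def)
  then obtain \<phi> where \<phi>: "\<And>b. b \<in> B \<Longrightarrow> \<phi> b \<in> F \<and> {b, \<phi> b} \<in> E \<and> \<chi> {b, \<phi> b} = 0"
    by (metis (mono_tags, lifting) mem_Collect_eq)
  have "inj_on \<phi> B"
  proof (rule inj_onI)
    fix a b assume ab: "a \<in> B" "b \<in> B" "\<phi> a = \<phi> b"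
    have "\<phi> a \<in> V" using \<phi>[OF ab(1)] bipartition by auto
    then have "{a, \<phi> a} = {b, \<phi> a}"
      using one_of_each_color[of "\<phi> a" 0] N_pos \<phi>[OF ab(1)] \<phi>[OF ab(2)] ab(3)
      by (metis insertCI less_eq_Suc_le One_nat_def)
    then show "a = b" by (auto simp: doubleton_eq_iff)
  qed
  moreover have "finite F" using finite_V bipartition by (metis finite_Un)
  ultimately show ?thesis using \<phi> by (intro card_inj_on_le[of \<phi>]) auto
qed

end

lemma transpose_boson_fermion_mat:
  "transpose_mat (boson_fermion_mat E \<mu> bs fs) = boson_fermion_mat E \<mu> fs bs"
  unfolding boson_fermion_mat_def by (rule eq_matI) (auto simp: insert_commute)


section \<open>The signed Laplacian\<close>

lemma symmetrized_laplacian: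
  fixes X Y :: "int mat"
  assumes X: "X \<in> carrier_mat n n" and Y: "Y \<in> carrier_mat n n"
    and XY: "X * transpose_mat Y + Y * transpose_mat X = 2 \<cdot>\<^sub>m 1\<^sub>m n"
      "transpose_mat X * Y + transpose_mat Y * X = 2 \<cdot>\<^sub>m 1\<^sub>m n"
  defines "U \<equiv> four_block_mat (0\<^sub>m n n) Y (transpose_mat Y) (0\<^sub>m n n)"
  shows "signed_laplacian N X * U + transpose_mat (signed_laplacian N X * U)
    = four_block_mat ((-2) \<cdot>\<^sub>m 1\<^sub>m n) ((2 * int N) \<cdot>\<^sub>m Y)
        ((2 * int N) \<cdot>\<^sub>m transpose_mat Y) ((-2) \<cdot>\<^sub>m 1\<^sub>m n)"
proof -
  let ?I = "1\<^sub>m n :: int mat" and ?N = "int N"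
  have c: "transpose_mat X \<in> carrier_mat n n" "transpose_mat Y \<in> carrier_mat n n"
    using X Y by auto
  have "signed_laplacian N X * U = four_block_mat (- (X * transpose_mat Y)) (?N \<cdot>\<^sub>m Y)
      (?N \<cdot>\<^sub>m transpose_mat Y) (- (transpose_mat X * Y))" (is "_ = ?LU")
  proof -
    have "(?N \<cdot>\<^sub>m ?I) * 0\<^sub>m n n + - X * transpose_mat Y = - (X * transpose_mat Y)"
      "(?N \<cdot>\<^sub>m ?I) * Y + - X * 0\<^sub>m n n = ?N \<cdot>\<^sub>m Y"
      "- transpose_mat X * 0\<^sub>m n n + (?N \<cdot>\<^sub>m ?I) * transpose_mat Y = ?N \<cdot>\<^sub>m transpose_mat Y"
      "- transpose_mat X * Y + (?N \<cdot>\<^sub>m ?I) * 0\<^sub>m n n = - (transpose_mat X * Y)"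
      using X Y c by (auto simp: uminus_mult_left_mat)
    then show ?thesis
      unfolding signed_laplacian_def U_def using X Y c
      by (subst mult_four_block_mat[of _ n n _ n _ n _ _ n _ n]) auto
  qed
  moreover have "transpose_mat ?LU = four_block_mat (- (Y * transpose_mat X)) (?N \<cdot>\<^sub>m Y)
      (?N \<cdot>\<^sub>m transpose_mat Y) (- (transpose_mat Y * X))"
  proof -
    have "transpose_mat (- (X * transpose_mat Y)) = - (Y * transpose_mat X)"
      "transpose_mat (- (transpose_mat X * Y)) = - (transpose_mat Y * X)"
      "transpose_mat (?N \<cdot>\<^sub>m Y) = ?N \<cdot>\<^sub>m transpose_mat Y"
      "transpose_mat (?N \<cdot>\<^sub>m transpose_mat Y) = ?N \<cdot>\<^sub>m Y"
      using transpose_mult[OF X c(2)] transpose_mult[OF c(1) Y] X Y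
      by (auto intro!: eq_matI simp: scalar_prod_def mult.commute)
    then show ?thesis
      using X Y c by (subst transpose_four_block_mat[of _ n n _ n _ n]) auto
  qed
  moreover have "- (X * transpose_mat Y) + - (Y * transpose_mat X) = (-2) \<cdot>\<^sub>m ?I"
    "- (transpose_mat X * Y) + - (transpose_mat Y * X) = (-2) \<cdot>\<^sub>m ?I"
    "?N \<cdot>\<^sub>m Y + ?N \<cdot>\<^sub>m Y = (2 * ?N) \<cdot>\<^sub>m Y"
    "?N \<cdot>\<^sub>m transpose_mat Y + ?N \<cdot>\<^sub>m transpose_mat Y = (2 * ?N) \<cdot>\<^sub>m transpose_mat Y"
  proof -
    have neg: "- A + - B = (-2) \<cdot>\<^sub>m ?I"
      if "A + B = 2 \<cdot>\<^sub>m ?I" "A \<in> carrier_mat n n" "B \<in> carrier_mat n n" for A B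
    proof -
      have "- A + - B = - (A + B)" using that(2,3) by (intro eq_matI) auto
      also have "\<dots> = (-2) \<cdot>\<^sub>m ?I" unfolding that(1) by (intro eq_matI) auto
      finally show ?thesis .
    qed
    show "- (X * transpose_mat Y) + - (Y * transpose_mat X) = (-2) \<cdot>\<^sub>m ?I"
      "- (transpose_mat X * Y) + - (transpose_mat Y * X) = (-2) \<cdot>\<^sub>m ?I"
      using X Y c by (auto intro!: neg XY)
  qed (use X Y in \<open>auto intro!: eq_matI\<close>)
  ultimately show ?thesis
    using X Y c by (auto simp: add_four_block_mat[of _ n n _ n _ n])
qed

theorem theorem20:
  fixes N p :: nat and V B F :: "'v set" and E :: "'v set set"
    and \<mu> :: "'v set \<Rightarrow> int" and \<chi> :: "'v set \<Rightarrow> nat" and h :: "'v \<Rightarrow> int"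
    and bs fs :: "'v list" and X L :: "int mat"
  assumes "adinkra N V B F E \<mu> \<chi> h"
    and "distinct bs" "set bs = B"
    and "distinct fs" "set fs = F"
    and "X = boson_fermion_mat E \<mu> bs fs"
    and "L = signed_laplacian N X"
    and "prime p" "odd p" "p dvd N"
  shows "(\<forall>ds. invariant_factors X ds \<longrightarrow> (\<forall>i < card V div 4. \<not> int p dvd ds ! i)) \<and>
         (\<forall>ds. invariant_factors L ds \<longrightarrow> (\<forall>i < card V div 2. \<not> int p dvd ds ! i))"
proof -
  note bs = assms(2,3) and fs = assms(4,5)
  interpret A: adinkra N V B F E \<mu> \<chi> h by fact
  interpret A': adinkra N V F B E \<mu> \<chi> h by (rule A.adinkra_swap)
  define n where "n = length bs"
  have "card B = n" using distinct_card[OF bs(1)] bs(2) n_def by simp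
  moreover have "card F = length fs" using distinct_card[OF fs(1)] fs(2) by simp
  moreover have "card B = card F"
    using A.card_bosons_le_card_fermions A'.card_bosons_le_card_fermions by simp
  ultimately have len: "length fs = n" by simp
  have card_V: "card V = n + n"
    using card_Un_disjoint[of B F] A.finite_V A.bipartition \<open>card B = n\<close> \<open>card B = card F\<close>
    by (metis finite_Un)
  define Y where "Y = boson_fermion_mat {e \<in> E. \<chi> e = 0} \<mu> bs fs"
  have carr: "X \<in> carrier_mat n n" "Y \<in> carrier_mat n n"
    unfolding assms(6) Y_def boson_fermion_mat_def using len n_def by auto
  have "0 < N" using A.N_pos by simp
  then have XY: "X * transpose_mat Y + Y * transpose_mat X = 2 \<cdot>\<^sub>m 1\<^sub>m n"
    using A.boson_fermion_mat_color_anticommute[OF bs fs] unfolding assms(6) Y_def n_def by simp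
  have YX: "transpose_mat X * Y + transpose_mat Y * X = 2 \<cdot>\<^sub>m 1\<^sub>m n"
    using A'.boson_fermion_mat_color_anticommute[OF fs bs \<open>0 < N\<close>]
    unfolding assms(6) Y_def len transpose_boson_fermion_mat .
  have prime: "prime (int p)" using assms(8) by simp
  have p2: "\<not> int p dvd 2"
  proof
    assume "int p dvd 2"
    then have "p dvd 2" using int_dvd_int_iff[of p 2] by simp
    then have "p = 2" using assms(8) primes_dvd_imp_eq two_is_prime_nat by blast
    then show False using assms(9) by simp
  qed

  have "\<not> int p dvd ds ! i" if ds: "invariant_factors X ds" and i: "i < card V div 4" for ds i
  proof (rule not_dvd_invariant_factor_if_symmetrization[OF carr(1) _ _ ds])
    have "transpose_mat (X * transpose_mat Y) = Y * transpose_mat X"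
      using transpose_mult[OF carr(1), of "transpose_mat Y"] carr by simp
    then have "det (X * transpose_mat Y + transpose_mat (X * transpose_mat Y)) = 2 ^ n"
      using XY by simp
    then show "\<not> int p dvd det (X * transpose_mat Y + transpose_mat (X * transpose_mat Y))"
      using p2 prime_dvd_power[OF prime, of 2 n] by auto
  qed (use carr i card_V in auto)
  moreover have "\<not> int p dvd ds ! i" if ds: "invariant_factors L ds" and i: "i < card V div 2" for ds i
  proof (rule not_dvd_invariant_factor_if_symmetrization[OF _ _ _ ds])
    let ?U = "four_block_mat (0\<^sub>m n n) Y (transpose_mat Y) (0\<^sub>m n n)"
    let ?T = "L * ?U + transpose_mat (L * ?U)"
    show L: "L \<in> carrier_mat (n + n) (n + n)" and U: "?U \<in> carrier_mat (n + n) (n + n)"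
      unfolding assms(7) signed_laplacian_def using carr by auto
    have T: "?T = four_block_mat ((-2) \<cdot>\<^sub>m 1\<^sub>m n) ((2 * int N) \<cdot>\<^sub>m Y)
        ((2 * int N) \<cdot>\<^sub>m transpose_mat Y) ((-2) \<cdot>\<^sub>m 1\<^sub>m n)"
      unfolding assms(7) by (rule symmetrized_laplacian[OF carr XY YX])
    have N0: "int p dvd 2 * int N * z" for z using assms(10) by simp
    have "[det ?T = det ((-2) \<cdot>\<^sub>m 1\<^sub>m (n + n))] (mod int p)"
    proof (rule det_cong)
      fix i j assume "i < n + n" "j < n + n"
      then show "[?T $$ (i, j) = ((-2) \<cdot>\<^sub>m 1\<^sub>m (n + n)) $$ (i, j)] (mod int p)"
        unfolding T using carr N0 by (auto simp: cong_0_iff)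
    qed (use L U in auto)
    then have "[det ?T = (-2) ^ (n + n)] (mod int p)" by simp
    then show "\<not> int p dvd det ?T"
      using p2 prime_dvd_power[OF prime, of "-2" "n + n"] by (auto simp: cong_dvd_iff)
    show "2 * i < n + n" using i card_V by simp
  qed
  ultimately show ?thesis by blast
qed

end
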